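(* Let $q:\mathbb{R}^n\times\mathbb{R}^n\to[0,+\infty)$ be a quasi distance for which there exist $\beta_1,\beta_2>0$ with $\beta_1\|x-y\|\le q(x,y)\le\beta_2\|x-y\|$ for all $x,y\in\mathbb{R}^n$. Let $\Gamma:[0,+\infty)\to\mathbb{R}$ be twice differentiable with $\Gamma[0]=\Gamma'[0]=0$ and $\Gamma'[s]>0$, $\Gamma''[s]>0$ for all $s>0$, and suppose that there are constants $r\in(0,1)$, $\bar q>0$ and $\bar\rho_\Gamma(r)>0$ such that $$\Gamma'[s/r]\le \bar\rho_\Gamma(r)\,\Gamma[s]/s,\qquad 0<s\le\bar q.$$ Let $f:\mathbb{R}^n\to\mathbb{R}\cup\{+\infty\}$ be a proper lower semicontinuous function that is bounded from below, continuous on $\operatorname{dom} f$, and a KL function. Let $0<\bar\lambda\le\tilde\lambda<+\infty$, $\sigma\in[0,1)$, $b>0$, and let $\{x^k\}$ be a bounded sequence generated by the inexact proximal algorithm (described in the context) with these parameters and with step parameters $\lambda_k\in[\bar\lambda,\tilde\lambda]$. Let $\tilde x$ be an accumulation point of $\{x^k\}$. Let $U\subset\mathbb{R}^n$ be a neighborhood of $\tilde x$, $\eta\in(0,+\infty]$, and $\varphi:[0,\eta)\to\mathbb{R}_+$ a continuous concave function such that $$\varphi(0)=0,\quad \varphi\in C^1(0,\eta),\quad \varphi'(s)>0\ \text{ for } s\in(0,\eta),$$ $$\varphi'(f(x)-f(\tilde x))\,\operatorname{dist}(0,\partial f(x))\ge 1\quad\text{for all } x\in U \text{ with } f(\tilde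 x)<f(x)<f(\tilde x)+\eta.$$ Let $\delta\in(0,\bar q)$ be such that $B(\tilde x,\delta/\beta_1)\subset U$. Let $\lambda_\infty$ be the limit of $\{\lambda_k\}$ (passing to a subsequence of $\{\lambda_k\}$ if necessary). Then the whole sequence $\{x^k\}$ converges to a critical point $x^*$ of $f$ (that is, $0\in\partial f(x^* )$), and, for every $\lambda_*>\lambda_\infty$, $x^*$ is a strong global trap relative to the worthwhile to change set $W_{\lambda_*}(x^* )$, that is, $W_{\lambda_*}(x^* )=\{x^*\}$; equivalently, $$f(x^* )-f(y)<\lambda_*\,\Gamma[q(x^*,y)]\qquad\text{for all } y\in\mathbb{R}^n,\ y\ne x^*.$$
   Context: **Quasi distance.** A quasi distance on $\mathbb{R}^n$ is a function $q:\mathbb{R}^n\times\mathbb{R}^n\to[0,+\infty)$ such that $q(x,y)=0$ if and only if $x=y$, and $q(x,z)\le q(x,y)+q(y,z)$ for all $x,y,z$. Symmetry is not required. **Subdifferentials.** Let $f:\mathbb{R}^n\to\mathbb{R}\cup\{+\infty\}$ be proper and lower semicontinuous, with $\operatorname{dom} f=\{x: f(x)<+\infty\}$. The Fréchet subdifferential at $x\in\operatorname{dom} f$ is $$\hat\partial f(x)=\Big\{x^*\in\mathbb{R}^n:\ \liminf_{y\to x,\,y\ne x}\tfrac{1}{\|x-y\|}\big(f(y)-f(x)-\langle x^*,y-x\rangle\big)\ge 0\Big\},$$ and $\hat\partial f(x)=\emptyset$ if $x\notin\operatorname{dom} f$. The limiting subdifferential at $x\in\operatorname{dom} f$ is $$\partial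 f(x)=\{x^*:\ \exists\, x_n\to x,\ f(x_n)\to f(x),\ x_n^*\in\hat\partial f(x_n),\ x_n^*\to x^*\},$$ and $\partial f(x)=\emptyset$ if $x\notin\operatorname{dom} f$. Here $\operatorname{dom}\partial f=\{x:\partial f(x)\neq\emptyset\}$. A point $x$ is called critical for $f$ if $0\in\partial f(x)$. Also $\operatorname{dist}(0,\partial f(x))=\inf\{\|v\|: v\in\partial f(x)\}$. The notation $\partial q(x,\cdot)(y)$ denotes the limiting subdifferential of the function $z\mapsto q(x,z)$ at the point $y$. $B(x,\rho)$ is the ball of center $x$ and radius $\rho$ for the Euclidean norm. **KL function.** A proper lower semicontinuous $f$ has the Kurdyka–Łojasiewicz property at $\bar x\in\operatorname{dom}\partial f$ if there exist $\eta\in(0,+\infty]$, a neighborhood $U$ of $\bar x$ and a continuous concave function $\varphi:[0,\eta)\to\mathbb{R}_+$ with $\varphi(0)=0$, $\varphi\in C^1(0,\eta)$, $\varphi'>0$ on $(0,\eta)$, such that $\varphi'(f(x)-f(\bar x))\operatorname{dist}(0,\partial f(x))\ge1$ for all $x\in U$ with $f(\bar x)<f(x)<f(\bar x)+\eta$. $f$ is a KL function if it has this property at every point of $\operatorname{dom}\partial f$. **The inexact proximal algorithm.** Given $x^0\in\operatorname{dom} f$, $0<\bar\lambda\le\tilde\lambda<+\infty$, $\sigma\in[0,1)$ and $b>0$: for each $k=0,1,2,\dots$ one chooses $\lambda_k\in[\bar\lambda,\tilde\lambda]$ and finds $(x^{k+1},w^{k+1},v^{k+1})\in\mathbb{R}^n\times\mathbb{R}^n\times\mathbb{R}^n$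 such that $$f(y)-f(x^{k+1})\ge\lambda_k\big[(1-\sigma)\Gamma[q(x^k,x^{k+1})]-\Gamma[q(x^k,y)]\big]\quad\text{for all } y\in\mathbb{R}^n,$$ $$w^{k+1}\in\partial f(x^{k+1}),\qquad v^{k+1}\in\partial q(x^k,\cdot)(x^{k+1}),$$ $$\|w^{k+1}\|\le b\,\Gamma'[q(x^k,x^{k+1})]\,\|v^{k+1}\|.$$ A sequence generated by the algorithm is any $\{x^k\}$ for which such $\lambda_k,w^{k+1},v^{k+1}$ exist. **Worthwhile to change set and strong global trap.** For $\lambda>0$ and $x\in\operatorname{dom} f$, $W_\lambda(x)=\{y\in\mathbb{R}^n:\ f(x)-f(y)\ge\lambda\,\Gamma[q(x,y)]\}$. The point $x$ is a strong global trap relative to $W_\lambda(x)$ if $W_\lambda(x)=\{x\}$. *)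

theory Defs
  imports "HOL-Analysis.Analysis"
begin

definition quasi_distance :: "('a \<Rightarrow> 'a \<Rightarrow> real) \<Rightarrow> bool" where
  "quasi_distance q \<longleftrightarrow>
     (\<forall>x y. 0 \<le> q x y) \<and> (\<forall>x y. q x y = 0 \<longleftrightarrow> x = y) \<and>
     (\<forall>x y z. q x z \<le> q x y + q y z)"

text \<open>Functions with values in the reals extended by plus infinity are \<open>ereal\<close>-valued functions
  that never take the value \<open>-\<infinity>\<close>; the latter is part of \<open>proper\<close>.\<close>

definition edom :: "('a \<Rightarrow> ereal) \<Rightarrow> 'a set" where
  "edom f = {x. f x < \<infinity>}"

definition proper :: "('a \<Rightarrow> ereal) \<Rightarrow> bool" where
  "proper f \<longleftrightarrow> (\<forall>x. f x \<noteq> -\<infinity>) \<and> edom f \<noteq> {}"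

definition lower_semicontinuous :: "('a::topological_space \<Rightarrow> ereal) \<Rightarrow> bool" where
  "lower_semicontinuous f \<longleftrightarrow> (\<forall>x. f x \<le> Liminf (at x) f)"

definition frechet_subdiff :: "('a::real_inner \<Rightarrow> ereal) \<Rightarrow> 'a \<Rightarrow> 'a set" where
  "frechet_subdiff f x =
     (if x \<in> edom f
      then {v. 0 \<le> Liminf (at x)
                    (\<lambda>y. (f y - f x - ereal (v \<bullet> (y - x))) / ereal (norm (x - y)))}
      else {})"

definition limiting_subdiff :: "('a::real_inner \<Rightarrow> ereal) \<Rightarrow> 'a \<Rightarrow> 'a set" where
  "limiting_subdiff f x =
     (if x \<in> edom f
      then {v. \<exists>xs vs. xs \<longlonglongrightarrow> x \<and> (\<lambda>n. f (xs n)) \<longlonglongrightarrow> f x \<and>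
                 (\<forall>n. vs n \<in> frechet_subdiff f (xs n)) \<and> vs \<longlonglongrightarrow> v}
      else {})"

definition critical_point :: "('a::real_inner \<Rightarrow> ereal) \<Rightarrow> 'a \<Rightarrow> bool" where
  "critical_point f x \<longleftrightarrow> 0 \<in> limiting_subdiff f x"

text \<open>The distance from 0 to the subdifferential is taken in \<open>ereal\<close>, so that it is \<open>\<infinity>\<close> (the infimum
  of the empty set) where the subdifferential is empty, whereas \<open>infdist\<close> and \<open>setdist\<close> would
  give 0.\<close>

definition subdiff_dist :: "('a::real_inner \<Rightarrow> ereal) \<Rightarrow> 'a \<Rightarrow> ereal" where
  "subdiff_dist f x = (INF v\<in>limiting_subdiff f x. ereal (norm v))"

text \<open>The end point \<open>\<eta>\<close> may be \<open>\<infinity>\<close>; the values of \<open>\<phi>\<close> outside the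
  interval from 0 to \<open>\<eta>\<close> play no role.\<close>

definition desingularizing :: "ereal \<Rightarrow> (real \<Rightarrow> real) \<Rightarrow> bool" where
  "desingularizing \<eta> \<phi> \<longleftrightarrow>
     continuous_on {s. 0 \<le> s \<and> ereal s < \<eta>} \<phi> \<and>
     concave_on {s. 0 \<le> s \<and> ereal s < \<eta>} \<phi> \<and>
     (\<forall>s. 0 \<le> s \<and> ereal s < \<eta> \<longrightarrow> 0 \<le> \<phi> s) \<and>
     \<phi> 0 = 0 \<and>
     (\<forall>s. 0 < s \<and> ereal s < \<eta> \<longrightarrow> \<phi> differentiable (at s)) \<and>
     continuous_on {s. 0 < s \<and> ereal s < \<eta>} (deriv \<phi>) \<and>
     (\<forall>s. 0 < s \<and> ereal s < \<eta> \<longrightarrow> 0 < deriv \<phi> s)"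

text \<open>For \<open>x\<close> as in the premise both \<open>f x\<close> and \<open>f xb\<close> are finite, provided that
  \<open>f xb \<noteq> -\<infinity>\<close>, so the conversion to a real is harmless.\<close>

definition KL_inequality ::
    "('a::real_inner \<Rightarrow> ereal) \<Rightarrow> 'a \<Rightarrow> 'a set \<Rightarrow> ereal \<Rightarrow> (real \<Rightarrow> real) \<Rightarrow> bool" where
  "KL_inequality f xb U \<eta> \<phi> \<longleftrightarrow>
     (\<forall>x\<in>U. f xb < f x \<and> f x < f xb + \<eta> \<longrightarrow>
        ereal (deriv \<phi> (real_of_ereal (f x - f xb))) * subdiff_dist f x \<ge> 1)"

definition KL_property_at :: "('a::real_inner \<Rightarrow> ereal) \<Rightarrow> 'a \<Rightarrow> bool" where
  "KL_property_at f xb \<longleftrightarrow>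
     (\<exists>\<eta> U \<phi>. 0 < \<eta> \<and> xb \<in> interior U \<and> desingularizing \<eta> \<phi> \<and> KL_inequality f xb U \<eta> \<phi>)"

definition KL_function :: "('a::real_inner \<Rightarrow> ereal) \<Rightarrow> bool" where
  "KL_function f \<longleftrightarrow>
     proper f \<and> lower_semicontinuous f \<and>
     (\<forall>xb. limiting_subdiff f xb \<noteq> {} \<longrightarrow> KL_property_at f xb)"

text \<open>In \<open>ereal\<close> one has \<open>\<infinity> - \<infinity> = \<infinity>\<close>. In the first inequality below this case does not
  arise, because membership of \<open>w\<close> in the subdifferential forces \<open>f (x (Suc k)) < \<infinity>\<close>.\<close>

definition inexact_proximal_sequence ::
    "('a::real_inner \<Rightarrow> ereal) \<Rightarrow> ('a \<Rightarrow> 'a \<Rightarrow> real) \<Rightarrow> (real \<Rightarrow> real) \<Rightarrow> (real \<Rightarrow> real) \<Rightarrow>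
     real \<Rightarrow> real \<Rightarrow> real \<Rightarrow> real \<Rightarrow> (nat \<Rightarrow> real) \<Rightarrow> (nat \<Rightarrow> 'a) \<Rightarrow> bool" where
  "inexact_proximal_sequence f q \<Gamma> \<Gamma>' lam_min lam_max \<sigma> b lam x \<longleftrightarrow>
     x 0 \<in> edom f \<and>
     (\<forall>k. lam k \<in> {lam_min..lam_max} \<and>
        (\<forall>y. f y - f (x (Suc k)) \<ge>
               ereal (lam k * ((1 - \<sigma>) * \<Gamma> (q (x k) (x (Suc k))) - \<Gamma> (q (x k) y)))) \<and>
        (\<exists>w v. w \<in> limiting_subdiff f (x (Suc k)) \<and>
               v \<in> limiting_subdiff (\<lambda>z. ereal (q (x k) z)) (x (Suc k)) \<and>
               norm w \<le> b * \<Gamma>' (q (x k) (x (Suc k))) * norm v))"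

definition worthwhile_set ::
    "('a \<Rightarrow> ereal) \<Rightarrow> ('a \<Rightarrow> 'a \<Rightarrow> real) \<Rightarrow> (real \<Rightarrow> real) \<Rightarrow> real \<Rightarrow> 'a \<Rightarrow> 'a set" where
  "worthwhile_set f q \<Gamma> l x = {y. f x - f y \<ge> ereal (l * \<Gamma> (q x y))}"

definition strong_global_trap ::
    "('a \<Rightarrow> ereal) \<Rightarrow> ('a \<Rightarrow> 'a \<Rightarrow> real) \<Rightarrow> (real \<Rightarrow> real) \<Rightarrow> real \<Rightarrow> 'a \<Rightarrow> bool" where
  "strong_global_trap f q \<Gamma> l x \<longleftrightarrow> worthwhile_set f q \<Gamma> l x = {x}"

end

theory Submission
  imports Defs
begin

text \<open>Along the sequence \<open>f\<close> decreases to \<open>f xt\<close>. Write \<open>d\<^sub>k = q (x\<^sub>k) (x\<^sub>k\<^sub>+\<^sub>1)\<close> and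
  \<open>\<phi>\<^sub>k = \<phi> (f x\<^sub>k - f xt)\<close>. Concavity of \<open>\<phi>\<close> combined with the KL inequality yields
  \<open>\<Gamma> (d\<^sub>k) \<le> C \<Gamma>' (d\<^sub>k\<^sub>-\<^sub>1) (\<phi>\<^sub>k - \<phi>\<^sub>k\<^sub>+\<^sub>1)\<close> as long as \<open>x\<^sub>k\<close> is close to \<open>xt\<close>. Either
  \<open>d\<^sub>k < r d\<^sub>k\<^sub>-\<^sub>1\<close>, or \<open>\<Gamma>' (d\<^sub>k\<^sub>-\<^sub>1) \<le> \<Gamma>' (d\<^sub>k / r) \<le> \<rho> \<Gamma> (d\<^sub>k) / d\<^sub>k\<close>; in both cases
  \<open>d\<^sub>k \<le> r d\<^sub>k\<^sub>-\<^sub>1 + C \<rho> (\<phi>\<^sub>k - \<phi>\<^sub>k\<^sub>+\<^sub>1)\<close>. Thus \<open>d\<^sub>k \<le> P\<^sub>k - P\<^sub>k\<^sub>+\<^sub>1\<close> for the vanishing potential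
  \<open>P\<^sub>k = (r d\<^sub>k\<^sub>-\<^sub>1 + C \<rho> \<phi>\<^sub>k) / (1 - r)\<close>, which traps the sequence near \<open>xt\<close> and makes it converge.
  Criticality and the trap property follow by passing to the limit.\<close>

section \<open>Limiting subdifferentials: closedness and Lipschitz bound\<close>

text \<open>Carrying the value \<open>f y\<close> as a middle component encodes
  \<open>f\<close>-attentive convergence, so the sequences in the definition become plain
  convergence in a product space. Topological facts about closures then apply.\<close>

lemma limiting_subdiff_iff_closure:
  fixes f :: "'a::real_inner \<Rightarrow> ereal"
  shows "v \<in> limiting_subdiff f x \<longleftrightarrow>
    x \<in> edom f \<and> (x, f x, v) \<in> closure {(y, f y, u) | y u. u \<in> frechet_subdiff f y}"
    (is "_ \<longleftrightarrow> _ \<and> _ \<in> closure ?G")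
proof -
  have "(x, f x, v) \<in> closure ?G \<longleftrightarrow>
      (\<exists>xs vs. xs \<longlonglongrightarrow> x \<and> (\<lambda>n. f (xs n)) \<longlonglongrightarrow> f x \<and>
         (\<forall>n. vs n \<in> frechet_subdiff f (xs n)) \<and> vs \<longlonglongrightarrow> v)" (is "_ \<longleftrightarrow> ?R")
  proof
    assume "(x, f x, v) \<in> closure ?G"
    then obtain g where g: "\<And>n. g n \<in> ?G" "g \<longlonglongrightarrow> (x, f x, v)"
      by (auto simp: closure_sequential)
    define xs vs where "xs n = fst (g n)" and "vs n = snd (snd (g n))" for n
    have mem: "fst (snd (g n)) = f (xs n)" "vs n \<in> frechet_subdiff f (xs n)" for n
      using g(1)[of n] by (auto simp: xs_def vs_def)
    have "xs \<longlonglongrightarrow> x" "vs \<longlonglongrightarrow> v" "(\<lambda>n. fst (snd (g n))) \<longlonglongrightarrow> f x"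
      using tendsto_fst[OF g(2)] tendsto_snd[OF tendsto_snd[OF g(2)]]
        tendsto_fst[OF tendsto_snd[OF g(2)]] by (simp_all add: xs_def[abs_def] vs_def[abs_def])
    with mem show ?R by auto
  next
    assume ?R
    then obtain xs vs where "xs \<longlonglongrightarrow> x" "(\<lambda>n. f (xs n)) \<longlonglongrightarrow> f x"
      "\<And>n. vs n \<in> frechet_subdiff f (xs n)" "vs \<longlonglongrightarrow> v" by auto
    then show "(x, f x, v) \<in> closure ?G"
      unfolding closure_sequential
      by (intro exI[of _ "\<lambda>n. (xs n, f (xs n), vs n)"]) (auto intro!: tendsto_Pair)
  qed
  then show ?thesis
    by (simp add: limiting_subdiff_def)
qed

text \<open>Each \<open>vs n\<close> is itself only a limit of Frechet subgradients; closedness of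
  the closure replaces a diagonal extraction.\<close>

lemma limiting_subdiff_closed:
  fixes f :: "'a::real_inner \<Rightarrow> ereal"
  assumes "x \<in> edom f" and "xs \<longlonglongrightarrow> x" and "(\<lambda>n. f (xs n)) \<longlonglongrightarrow> f x"
    and "\<And>n. vs n \<in> limiting_subdiff f (xs n)" and "vs \<longlonglongrightarrow> v"
  shows "v \<in> limiting_subdiff f x"
proof -
  let ?G = "{(y, f y, u) | y u. u \<in> frechet_subdiff f y}"
  have "(xs n, f (xs n), vs n) \<in> closure ?G" for n
    using assms(4)[of n] by (simp add: limiting_subdiff_iff_closure)
  moreover have "(\<lambda>n. (xs n, f (xs n), vs n)) \<longlonglongrightarrow> (x, f x, v)"
    using assms by (intro tendsto_Pair)
  ultimately have "(x, f x, v) \<in> closure ?G"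
    by (rule closed_sequentially[OF closed_closure])
  with assms(1) show ?thesis
    by (simp add: limiting_subdiff_iff_closure)
qed

text \<open>Test the subgradient along its own direction \<open>v\<close>: at
  \<open>x + t *\<^sub>R v\<close> the linear part grows by \<open>t * (norm v)\<^sup>2\<close>,
  while \<open>g\<close> grows by at most \<open>L * (t * norm v)\<close>. Dividing by
  \<open>t * norm v\<close> leaves \<open>norm v \<le> L + e\<close>.\<close>

lemma norm_frechet_subdiff_le:
  fixes g :: "'a::real_inner \<Rightarrow> real"
  assumes lip: "\<And>y z. g z - g y \<le> L * norm (z - y)" and "0 \<le> L"
    and v: "v \<in> frechet_subdiff (\<lambda>z. ereal (g z)) x"
  shows "norm v \<le> L"
proof (cases "v = 0")
  case False
  show ?thesis
  proof (rule field_le_epsilon)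
    fix e :: real assume "0 < e"
    have "0 \<le> Liminf (at x)
        (\<lambda>y. (ereal (g y) - ereal (g x) - ereal (v \<bullet> (y - x))) / ereal (norm (x - y)))"
      using v by (auto simp: frechet_subdiff_def split: if_splits)
    then have "\<forall>\<^sub>F y in at x. ereal (- e) <
        (ereal (g y) - ereal (g x) - ereal (v \<bullet> (y - x))) / ereal (norm (x - y))"
      unfolding le_Liminf_iff using \<open>0 < e\<close> by simp
    then obtain \<epsilon> where "0 < \<epsilon>" and \<epsilon>: "\<And>y. y \<noteq> x \<Longrightarrow> dist y x < \<epsilon> \<Longrightarrow> ereal (- e) <
        (ereal (g y) - ereal (g x) - ereal (v \<bullet> (y - x))) / ereal (norm (x - y))"
      unfolding eventually_at by blast
    \<comment> \<open>This \<open>t\<close> places the test point at distance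
      \<open>\<epsilon> / 2\<close> from \<open>x\<close>.\<close>
    define t where "t = \<epsilon> / (2 * norm v)"
    have t: "0 < t" "t * norm v < \<epsilon>"
      using False \<open>0 < \<epsilon>\<close> by (auto simp: t_def)
    have "ereal (- e) < (ereal (g (x + t *\<^sub>R v)) - ereal (g x) -
        ereal (v \<bullet> (x + t *\<^sub>R v - x))) / ereal (norm (x - (x + t *\<^sub>R v)))"
      using t False by (intro \<epsilon>) (auto simp: dist_norm)
    then have "- e < (g (x + t *\<^sub>R v) - g x - t * (norm v)\<^sup>2) / (t * norm v)"
      using t False by (simp add: dot_square_norm)
    then have "- e * (t * norm v) < g (x + t *\<^sub>R v) - g x - t * (norm v)\<^sup>2"
      using t False by (simp add: pos_less_divide_eq)
    also have "\<dots> \<le> L * (t * norm v) - norm v * (t * norm v)"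
      using lip[of "x + t *\<^sub>R v" x] t by (simp add: power2_eq_square)
    finally have "norm v * (t * norm v) < (L + e) * (t * norm v)"
      by (simp add: algebra_simps)
    then show "norm v \<le> L + e"
      using t False by (simp add: mult_less_cancel_right)
  qed
qed (use \<open>0 \<le> L\<close> in simp)

lemma norm_limiting_subdiff_le:
  fixes g :: "'a::real_inner \<Rightarrow> real"
  assumes lip: "\<And>y z. g z - g y \<le> L * norm (z - y)" and "0 \<le> L"
    and v: "v \<in> limiting_subdiff (\<lambda>z. ereal (g z)) x"
  shows "norm v \<le> L"
proof -
  obtain xs vs where "\<And>n. vs n \<in> frechet_subdiff (\<lambda>z. ereal (g z)) (xs n)" "vs \<longlonglongrightarrow> v"
    using v by (auto simp: limiting_subdiff_def split: if_splits)
  then have "\<forall>n. norm (vs n) \<le> L" "(\<lambda>n. norm (vs n)) \<longlonglongrightarrow> norm v"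
    using norm_frechet_subdiff_le[OF lip \<open>0 \<le> L\<close>] by (auto intro: tendsto_norm)
  then show ?thesis
    by (auto intro: LIMSEQ_le_const2)
qed

section \<open>Semicontinuity along sequences and strict monotonicity\<close>

lemma lower_semicontinuous_LIMSEQ_le:
  assumes f: "lower_semicontinuous f" and xs: "xs \<longlonglongrightarrow> x" and lim: "(\<lambda>n. f (xs n)) \<longlonglongrightarrow> l"
  shows "f x \<le> l"
proof (rule ccontr)
  assume "\<not> f x \<le> l"
  then obtain c where c: "l < c" "c < f x"
    using dense[of l "f x"] by (auto simp: not_le)
  have "\<forall>\<^sub>F y in at x. c < f y"
    using f c(2) unfolding lower_semicontinuous_def le_Liminf_iff by blast
  \<comment> \<open>The \<open>Liminf\<close> is over a punctured neighborhood;
    \<open>c < f x\<close> adds the center, since \<open>xs\<close> may hit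
    \<open>x\<close>.\<close>
  then have "\<forall>\<^sub>F y in nhds x. c < f y"
    using c(2) by (auto simp: eventually_at_filter elim!: eventually_mono)
  then have "\<forall>\<^sub>F n in sequentially. c < f (xs n)"
    using xs by (auto simp: filterlim_iff)
  then have "c \<le> l"
    by (intro tendsto_lowerbound[OF lim]) (auto elim: eventually_mono)
  with c show False by simp
qed

text \<open>The derivative at 0 is one-sided and may vanish there; the mean value argument needs
  positive derivatives only in the open interval and continuity at its ends. It serves both
  \<open>\<Gamma>\<close> and \<open>\<Gamma>'\<close>.\<close>

lemma has_real_derivative_pos_imp_less:
  fixes g g' :: "real \<Rightarrow> real"
  assumes deriv: "\<And>s. 0 \<le> s \<Longrightarrow> (g has_real_derivative g' s) (at s within {0..})"
    and pos: "\<And>s. 0 < s \<Longrightarrow> 0 < g' s" and "0 \<le> s" "s < t"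
  shows "g s < g t"
proof (rule DERIV_pos_imp_increasing_open[OF \<open>s < t\<close>])
  fix u assume "s < u" "u < t"
  then have "0 < u" using \<open>0 \<le> s\<close> by simp
  moreover have "at u within {0..} = at u"
    using \<open>0 < u\<close> by (intro at_within_interior) simp
  ultimately show "\<exists>y. (g has_real_derivative y) (at u) \<and> 0 < y"
    using deriv[of u] pos[of u] by auto
next
  have "continuous_on {0..} g"
    using deriv by (auto intro: DERIV_continuous_on)
  then show "continuous_on {s..t} g"
    using \<open>0 \<le> s\<close> by (rule_tac continuous_on_subset) auto
qed

section \<open>Desingularizing functions and the KL inequality\<close>

text \<open>A concave function lies below its tangent at \<open>s\<close>; evaluated at
  \<open>t \<le> s\<close>, this turns a decrease of the objective into a decrease of
  \<open>\<phi>\<close>.\<close>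

lemma desingularizing_tangent:
  assumes \<phi>: "desingularizing \<eta> \<phi>" and s: "0 < s" "ereal s < \<eta>" and t: "0 \<le> t" "t \<le> s"
  shows "deriv \<phi> s * (s - t) \<le> \<phi> s - \<phi> t"
proof -
  let ?A = "{s. 0 \<le> s \<and> ereal s < \<eta>}"
  have conv: "convex_on ?A (\<lambda>s. - \<phi> s)" and diff: "\<phi> differentiable (at s)"
    using \<phi> s by (auto simp: desingularizing_def concave_on_def)
  have "connected ?A"
    using conv convex_on_imp_convex convex_connected by blast
  \<comment> \<open>The tangent inequality needs \<open>s\<close> in the interior of the domain; an
    intermediate \<open>s'\<close> gives an open interval around \<open>s\<close> whether or not
    \<open>\<eta>\<close> is infinite.\<close>
  moreover obtain s' where s': "s < s'" "ereal s' < \<eta>"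
    using ereal_dense2[OF s(2)] by auto
  then have "s \<in> interior ?A"
    using s by (intro interiorI[of "{0<..<s'}"])
      (auto intro: less_trans[of "ereal _" "ereal s'"])
  moreover have "t \<in> ?A"
    using s t by (auto intro: le_less_trans[of "ereal t" "ereal s"])
  moreover have "(\<phi> has_real_derivative deriv \<phi> s) (at s)"
    using diff DERIV_deriv_iff_real_differentiable by blast
  then have "((\<lambda>s. - \<phi> s) has_real_derivative - deriv \<phi> s) (at s within ?A)"
    by (rule DERIV_minus[OF has_field_derivative_at_within])
  ultimately have "- deriv \<phi> s * (t - s) \<le> - \<phi> t - - \<phi> s"
    by (rule convex_on_imp_above_tangent[OF conv])
  then show ?thesis
    by (simp add: algebra_simps)
qed

lemma desingularizing_tendsto_zero:
  assumes \<phi>: "desingularizing \<eta> \<phi>" and "0 < \<eta>" and s: "s \<longlonglongrightarrow> 0"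
    and dom: "\<forall>\<^sub>F k in sequentially. 0 \<le> s k \<and> ereal (s k) < \<eta>"
  shows "(\<lambda>k. \<phi> (s k)) \<longlonglongrightarrow> 0"
proof -
  have "(\<lambda>k. \<phi> (s k)) \<longlonglongrightarrow> \<phi> 0"
    using \<phi> dom \<open>0 < \<eta>\<close>
    by (intro continuous_on_tendsto_compose[OF _ s, of "{s. 0 \<le> s \<and> ereal s < \<eta>}"])
      (auto simp: desingularizing_def zero_ereal_def)
  then show ?thesis
    using \<phi> by (simp add: desingularizing_def)
qed

text \<open>The norm of any one subgradient bounds the distance from above, and the positive factor
  \<open>deriv \<phi>\<close> preserves this. The result is an inequality between reals.\<close>

lemma KL_inequality_norm:
  assumes KL: "KL_inequality f xb U \<eta> \<phi>" and \<phi>: "desingularizing \<eta> \<phi>"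
    and "z \<in> U" and w: "w \<in> limiting_subdiff f z"
    and fin: "f z = ereal a" "f xb = ereal c" and ac: "c < a" "ereal (a - c) < \<eta>"
  shows "1 \<le> deriv \<phi> (a - c) * norm w"
proof -
  have "ereal a < ereal c + \<eta>"
    using ac(2) by (cases \<eta>) auto
  then have "1 \<le> ereal (deriv \<phi> (a - c)) * subdiff_dist f z"
    using KL \<open>z \<in> U\<close> fin ac by (auto simp: KL_inequality_def)
  also have "\<dots> \<le> ereal (deriv \<phi> (a - c)) * ereal (norm w)"
  proof (rule ereal_mult_left_mono)
    show "subdiff_dist f z \<le> ereal (norm w)"
      unfolding subdiff_dist_def using w by (rule INF_lower)
    show "0 \<le> ereal (deriv \<phi> (a - c))"
      using \<phi> ac by (auto simp: desingularizing_def less_imp_le)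
  qed
  finally show ?thesis
    by (simp add: one_ereal_def)
qed

section \<open>From local potential descent to convergence\<close>

text \<open>The step bounds telescope, so from index \<open>M\<close> on the sequence moves by at
  most \<open>P M\<close>. If \<open>dist (x M) l + P M\<close> is below the radius, the iterates
  never leave the ball in which the step bound is available. The subsequence supplies such an
  \<open>M\<close>.\<close>

lemma tendsto_of_local_potential_descent:
  fixes x :: "nat \<Rightarrow> 'a::metric_space" and P :: "nat \<Rightarrow> real"
  assumes sub: "strict_mono \<tau>" "(x \<circ> \<tau>) \<longlonglongrightarrow> l"
    and P: "P \<longlonglongrightarrow> 0" "\<And>k. N \<le> k \<Longrightarrow> 0 \<le> P k" and "0 < \<epsilon>"
    and step: "\<And>k. N \<le> k \<Longrightarrow> dist (x k) l < \<epsilon> \<Longrightarrow> dist (x k) (x (Suc k)) \<le> P k - P (Suc k)"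
  shows "x \<longlonglongrightarrow> l"
proof (rule metric_LIMSEQ_I)
  fix e :: real assume "0 < e"
  let ?e = "min e \<epsilon>"
  have "(\<lambda>n. dist (x (\<tau> n)) l + P (\<tau> n)) \<longlonglongrightarrow> 0 + 0"
    using sub(2) LIMSEQ_subseq_LIMSEQ[OF P(1) sub(1)]
    by (intro tendsto_add) (auto simp: o_def tendsto_dist_iff[symmetric])
  then have "\<forall>\<^sub>F n in sequentially. dist (x (\<tau> n)) l + P (\<tau> n) < ?e"
    using \<open>0 < e\<close> \<open>0 < \<epsilon>\<close> by (intro order_tendstoD(2)) auto
  then have "\<forall>\<^sub>F n in sequentially. dist (x (\<tau> n)) l + P (\<tau> n) < ?e \<and> N \<le> n"
    using eventually_ge_at_top by (rule eventually_conj)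
  then obtain n where n: "dist (x (\<tau> n)) l + P (\<tau> n) < ?e" "N \<le> n"
    using eventually_happens'[OF sequentially_bot] by blast
  define M where "M = \<tau> n"
  have M: "dist (x M) l + P M < ?e" "N \<le> M"
    using n seq_suble[OF sub(1), of n] by (auto simp: M_def)
  have near: "dist (x M) (x k) \<le> P M - P k" "dist (x k) l < ?e" if "M \<le> k" for k
  proof -
    \<comment> \<open>Stated apart because each induction step needs it to re-establish the premise
      \<open>dist (x k) l < \<epsilon>\<close>.\<close>
    have close: "dist (x k) l < ?e" if "dist (x M) (x k) \<le> P M - P k" "M \<le> k" for k
      using M that P(2)[of k] dist_triangle[of "x k" l "x M"] by (simp add: dist_commute)
    show *: "dist (x M) (x k) \<le> P M - P k"
      using that
    proof (induction k rule: dec_induct)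
      case (step k)
      then have "dist (x k) (x (Suc k)) \<le> P k - P (Suc k)"
        using assms(6)[of k] close[of k] M(2) by simp
      then show ?case
        using step.IH dist_triangle[of "x M" "x (Suc k)" "x k"] by linarith
    qed simp
    show "dist (x k) l < ?e" by (rule close[OF * that])
  qed
  have "dist (x k) l < e" if "M \<le> k" for k
    using near(2)[OF that] by simp
  then show "\<exists>no. \<forall>n\<ge>no. dist (x n) l < e"
    by blast
qed

theorem theorem4p1:
  fixes q :: "real ^ 'n \<Rightarrow> real ^ 'n \<Rightarrow> real"
    and f :: "real ^ 'n \<Rightarrow> ereal"
    and \<Gamma> \<Gamma>' \<Gamma>'' :: "real \<Rightarrow> real"
    and \<beta>1 \<beta>2 r qbar \<rho> lam_min lam_max \<sigma> b \<delta> lam_inf :: real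
    and lam :: "nat \<Rightarrow> real"
    and x :: "nat \<Rightarrow> real ^ 'n"
    and xt :: "real ^ 'n"
    and U :: "(real ^ 'n) set"
    and \<eta> :: ereal
    and \<phi> :: "real \<Rightarrow> real"
    and \<kappa> :: "nat \<Rightarrow> nat"
  assumes q: "quasi_distance q"
    and "0 < \<beta>1" and "0 < \<beta>2"
    and q_norm: "\<And>y z. \<beta>1 * norm (y - z) \<le> q y z \<and> q y z \<le> \<beta>2 * norm (y - z)"
    and \<Gamma>_deriv: "\<And>s. 0 \<le> s \<Longrightarrow> (\<Gamma> has_real_derivative \<Gamma>' s) (at s within {0..})"
    and \<Gamma>_deriv2: "\<And>s. 0 \<le> s \<Longrightarrow> (\<Gamma>' has_real_derivative \<Gamma>'' s) (at s within {0..})"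
    and \<Gamma>_zero: "\<Gamma> 0 = 0" "\<Gamma>' 0 = 0"
    and \<Gamma>_pos: "\<And>s. 0 < s \<Longrightarrow> 0 < \<Gamma>' s" "\<And>s. 0 < s \<Longrightarrow> 0 < \<Gamma>'' s"
    and "0 < r" "r < 1" and "0 < qbar" and "0 < \<rho>"
    and \<Gamma>_growth: "\<And>s. 0 < s \<Longrightarrow> s \<le> qbar \<Longrightarrow> \<Gamma>' (s / r) \<le> \<rho> * \<Gamma> s / s"
    and f: "proper f" "lower_semicontinuous f"
    and f_bdd: "\<exists>m::real. \<forall>y. ereal m \<le> f y"
    and f_cont: "continuous_on (edom f) f"
    and f_KL: "KL_function f"
    and "0 < lam_min" "lam_min \<le> lam_max"
    and "0 \<le> \<sigma>" "\<sigma> < 1" and "0 < b"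
    and x: "inexact_proximal_sequence f q \<Gamma> \<Gamma>' lam_min lam_max \<sigma> b lam x"
    and x_bdd: "bounded (range x)"
    and xt: "\<exists>\<tau>::nat \<Rightarrow> nat. strict_mono \<tau> \<and> (x \<circ> \<tau>) \<longlonglongrightarrow> xt"
    and U: "xt \<in> interior U"
    and "0 < \<eta>"
    and \<phi>: "desingularizing \<eta> \<phi>"
    and KL_xt: "KL_inequality f xt U \<eta> \<phi>"
    and "0 < \<delta>" "\<delta> < qbar"
    and ball_U: "ball xt (\<delta> / \<beta>1) \<subseteq> U"
    and lam_inf: "strict_mono \<kappa>" "(lam \<circ> \<kappa>) \<longlonglongrightarrow> lam_inf"
  shows "\<exists>xstar. x \<longlonglongrightarrow> xstar \<and> critical_point f xstar \<and>
           (\<forall>lam_star > lam_inf.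
              strong_global_trap f q \<Gamma> lam_star xstar \<and>
              (\<forall>y. y \<noteq> xstar \<longrightarrow> f xstar - f y < ereal (lam_star * \<Gamma> (q xstar y))))"
proof -

  \<comment> \<open>Elementary properties of \<open>q\<close> and \<open>\<Gamma>\<close>\<close>
  define d where "d k = q (x k) (x (Suc k))" for k
  have q_nonneg: "0 \<le> q y z" and q_refl: "q y y = 0" and q_eq: "q y z = 0 \<longleftrightarrow> y = z"
    and q_tri: "q y z \<le> q y u + q u z" for y z u
    using q by (auto simp: quasi_distance_def)
  have \<Gamma>_less: "\<Gamma> s < \<Gamma> t" if "0 \<le> s" "s < t" for s t
    using has_real_derivative_pos_imp_less[OF \<Gamma>_deriv \<Gamma>_pos(1) that] .
  have \<Gamma>'_less: "\<Gamma>' s < \<Gamma>' t" if "0 \<le> s" "s < t" for s t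
    using has_real_derivative_pos_imp_less[OF \<Gamma>_deriv2 \<Gamma>_pos(2) that] .
  have \<Gamma>_nonneg: "0 \<le> \<Gamma> s" if "0 \<le> s" for s
    using \<Gamma>_less[of 0 s] \<Gamma>_zero that by (cases "s = 0") auto
  have \<Gamma>'_nonneg: "0 \<le> \<Gamma>' s" if "0 \<le> s" for s
    using \<Gamma>'_less[of 0 s] \<Gamma>_zero that by (cases "s = 0") auto
  have \<Gamma>_cont: "continuous_on {0..} \<Gamma>" and \<Gamma>'_cont: "continuous_on {0..} \<Gamma>'"
    using \<Gamma>_deriv \<Gamma>_deriv2 by (auto intro: DERIV_continuous_on)
  have d_nonneg: "0 \<le> d k" for k
    by (simp add: d_def q_nonneg)

  \<comment> \<open>Bounding the subgradients of \<open>f\<close> by the step lengths\<close>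
  have lam: "lam_min \<le> lam k" "lam k \<le> lam_max"
    and prox: "f y - f (x (Suc k)) \<ge> ereal (lam k * ((1 - \<sigma>) * \<Gamma> (d k) - \<Gamma> (q (x k) y)))" for k y
    using x by (auto simp: inexact_proximal_sequence_def d_def)
  obtain w v where w: "\<And>k. w k \<in> limiting_subdiff f (x (Suc k))"
    and v: "\<And>k. v k \<in> limiting_subdiff (\<lambda>z. ereal (q (x k) z)) (x (Suc k))"
    and wv: "\<And>k. norm (w k) \<le> b * \<Gamma>' (d k) * norm (v k)"
    using x unfolding inexact_proximal_sequence_def d_def by metis
  \<comment> \<open>The triangle inequality makes \<open>q y\<close> Lipschitz with constant
    \<open>\<beta>2\<close>, which bounds its subgradients \<open>v k\<close>.\<close>
  have q_lip: "q y z - q y u \<le> \<beta>2 * norm (z - u)" for y z u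
    using q_tri[of y z u] q_norm[of u z] by (simp add: norm_minus_commute)
  have w_le: "norm (w k) \<le> b * \<beta>2 * \<Gamma>' (d k)" for k
  proof -
    have "norm (v k) \<le> \<beta>2"
      by (rule norm_limiting_subdiff_le[OF q_lip _ v]) (use \<open>0 < \<beta>2\<close> in simp)
    then have "b * \<Gamma>' (d k) * norm (v k) \<le> b * \<Gamma>' (d k) * \<beta>2"
      using \<open>0 < b\<close> \<Gamma>'_nonneg[OF d_nonneg] by (intro mult_left_mono) auto
    with wv[of k] show ?thesis by (simp add: mult_ac)
  qed

  \<comment> \<open>Decrease of the objective values\<close>
  obtain m :: real where m: "\<And>y. ereal m \<le> f y"
    using f_bdd by auto
  have dom: "x k \<in> edom f" for k
  proof (cases k)
    case 0
    then show ?thesis using x by (simp add: inexact_proximal_sequence_def)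
  next
    case (Suc j)
    then show ?thesis using w[of j] by (auto simp: limiting_subdiff_def split: if_splits)
  qed
  define F where "F k = real_of_ereal (f (x k))" for k
  have F: "f (x k) = ereal (F k)" for k
    using dom[of k] m[of "x k"] by (cases "f (x k)") (auto simp: F_def edom_def)
  have descent: "lam_min * (1 - \<sigma>) * \<Gamma> (d k) \<le> F k - F (Suc k)" for k
  proof -
    have "lam_min * ((1 - \<sigma>) * \<Gamma> (d k)) \<le> lam k * ((1 - \<sigma>) * \<Gamma> (d k))"
      using lam \<open>\<sigma> < 1\<close> \<Gamma>_nonneg[OF d_nonneg] by (intro mult_right_mono) auto
    \<comment> \<open>Staying put, \<open>y = x k\<close>, is the test point, and its cost
      \<open>\<Gamma> (q (x k) (x k))\<close> is zero.\<close>
    also have "\<dots> \<le> F k - F (Suc k)"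
      using prox[where y = "x k" and k = k] by (simp add: F q_refl \<Gamma>_zero)
    finally show ?thesis by (simp add: mult_ac)
  qed
  have "0 \<le> lam_min * (1 - \<sigma>) * \<Gamma> (d k)" for k
    using \<open>0 < lam_min\<close> \<open>\<sigma> < 1\<close> \<Gamma>_nonneg[OF d_nonneg] by simp
  then have "decseq F"
    using descent by (intro decseq_SucI) (smt (verit))
  moreover have "\<forall>k. m \<le> F k"
    using m F by (metis ereal_less_eq(3))
  ultimately obtain Finf where Finf: "F \<longlonglongrightarrow> Finf" "\<And>k. Finf \<le> F k"
    by (rule decseq_convergent) auto
  have f_lim: "(\<lambda>k. f (x k)) \<longlonglongrightarrow> ereal Finf"
    using Finf(1) by (simp add: F)

  \<comment> \<open>Vanishing of step lengths and subgradients\<close>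
  have "(\<lambda>k. \<Gamma> (d k)) \<longlonglongrightarrow> 0"
  proof (rule tendsto_sandwich[OF _ _ tendsto_const])
    show "(\<lambda>k. (F k - F (Suc k)) / (lam_min * (1 - \<sigma>))) \<longlonglongrightarrow> 0"
      using tendsto_divide_zero[OF tendsto_diff[OF Finf(1) LIMSEQ_Suc[OF Finf(1)], simplified]] .
    show "\<forall>\<^sub>F k in sequentially. \<Gamma> (d k) \<le> (F k - F (Suc k)) / (lam_min * (1 - \<sigma>))"
      using descent \<open>0 < lam_min\<close> \<open>\<sigma> < 1\<close> by (auto simp: pos_le_divide_eq mult_ac)
  qed (auto simp: \<Gamma>_nonneg d_nonneg)
  have d_lim: "d \<longlonglongrightarrow> 0"
  proof (rule order_tendstoI)
    fix e :: real assume "0 < e"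
    then have "\<forall>\<^sub>F k in sequentially. \<Gamma> (d k) < \<Gamma> e"
      using \<open>(\<lambda>k. \<Gamma> (d k)) \<longlonglongrightarrow> 0\<close> \<Gamma>_less[of 0 e] \<Gamma>_zero by (auto intro: order_tendstoD)
    then show "\<forall>\<^sub>F k in sequentially. d k < e"
      by eventually_elim (use \<Gamma>_less[of e] \<open>0 < e\<close> in \<open>force simp: not_less le_less\<close>)
  qed (auto intro: less_le_trans[OF _ d_nonneg] always_eventually)
  have "(\<lambda>k. \<Gamma>' (d k)) \<longlonglongrightarrow> \<Gamma>' 0"
    by (rule continuous_on_tendsto_compose[OF \<Gamma>'_cont d_lim]) (auto simp: d_nonneg)
  then have "(\<lambda>k. b * \<beta>2 * \<Gamma>' (d k)) \<longlonglongrightarrow> 0"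
    unfolding \<Gamma>_zero by (rule tendsto_mult_right_zero)
  then have w_lim: "w \<longlonglongrightarrow> 0"
    by (rule Lim_null_comparison[OF always_eventually[OF allI[OF w_le]]])

  \<comment> \<open>The objective value at the accumulation point\<close>
  obtain \<tau> where \<tau>: "strict_mono \<tau>" "(x \<circ> \<tau>) \<longlonglongrightarrow> xt"
    using xt by auto
  have f_sub: "(\<lambda>k. f (x (\<tau> k))) \<longlonglongrightarrow> ereal Finf"
    using LIMSEQ_subseq_LIMSEQ[OF f_lim \<tau>(1)] by (simp add: o_def)
  \<comment> \<open>Semicontinuity puts \<open>xt\<close> in the domain, so that continuity on the
    domain can then identify the value.\<close>
  have "f xt \<le> ereal Finf"
    using lower_semicontinuous_LIMSEQ_le[OF f(2) \<tau>(2)] f_sub by simp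
  then have xt_dom: "xt \<in> edom f"
    by (auto simp: edom_def)
  have "(\<lambda>k. f ((x \<circ> \<tau>) k)) \<longlonglongrightarrow> f xt"
    by (rule continuous_on_tendsto_compose[OF f_cont \<tau>(2) xt_dom]) (simp add: dom)
  then have f_xt: "f xt = ereal Finf"
    using LIMSEQ_unique[OF f_sub] by simp

  \<comment> \<open>Convergence of the whole sequence\<close>
  have conv: "x \<longlonglongrightarrow> xt"
  \<comment> \<open>The KL inequality applies only at values strictly above \<open>f xt\<close>. If
    the limit value is reached, descent forces \<open>d k = 0\<close> from then on and the sequence
    is stationary.\<close>
  proof (cases "\<exists>N. F N = Finf")
    case True
    then obtain N where N: "F N = Finf" ..
    have const: "x k = x N" if "N \<le> k" for k
      using that
    proof (induction k rule: dec_induct)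
      case (step k)
      have "F k = Finf"
        using step.hyps N Finf(2) decseqD[OF \<open>decseq F\<close>, of N k] by (metis antisym)
      then have "lam_min * (1 - \<sigma>) * \<Gamma> (d k) \<le> 0"
        using descent[of k] Finf(2)[of "Suc k"] by simp
      then have "\<Gamma> (d k) \<le> 0"
        using \<open>0 < lam_min\<close> \<open>\<sigma> < 1\<close> by (simp add: mult_le_0_iff)
      then have "d k = 0"
        using \<Gamma>_less[of 0 "d k"] d_nonneg[of k] \<Gamma>_zero by force
      then show ?case
        using step.IH q_eq by (simp add: d_def)
    qed simp
    have "x \<longlonglongrightarrow> x N"
      by (rule tendsto_eventually, rule eventually_sequentiallyI, rule const)
    moreover have "x N = xt"
      using LIMSEQ_unique[OF LIMSEQ_subseq_LIMSEQ[OF calculation \<tau>(1)] \<tau>(2)] .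
    ultimately show ?thesis by simp
  next
    case False
    define S where "S k = F k - Finf" for k
    have S_pos: "0 < S k" for k
      using False Finf(2)[of k] by (auto simp: S_def le_less)
    have S_lim: "S \<longlonglongrightarrow> 0"
      using Finf(1) unfolding S_def by (rule LIM_zero)
    have S_dec: "S (Suc k) \<le> S k" for k
      using decseq_SucD[OF \<open>decseq F\<close>] by (simp add: S_def)
    have "\<forall>\<^sub>F k in sequentially. ereal (S k) < \<eta>"
      using S_lim \<open>0 < \<eta>\<close> by (intro order_tendstoD(2)[of _ 0]) (auto simp: zero_ereal_def)
    moreover have "\<forall>\<^sub>F k in sequentially. d k < qbar"
      using d_lim \<open>0 < qbar\<close> by (rule order_tendstoD)
    ultimately obtain N where N: "\<And>k. N \<le> k \<Longrightarrow> ereal (S k) < \<eta>" "\<And>k. N \<le> k \<Longrightarrow> d k < qbar"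
      unfolding eventually_sequentially by (metis le_trans nat_le_linear)
    obtain \<epsilon> where \<epsilon>: "0 < \<epsilon>" "ball xt \<epsilon> \<subseteq> U"
      using U by (auto simp: mem_interior)
    \<comment> \<open>\<open>C\<close> collects the subgradient bound \<open>b * \<beta>2\<close>,
      the descent constant \<open>lam_min * (1 - \<sigma>)\<close> and the growth constant
      \<open>\<rho>\<close>.\<close>
    define C where "C = b * \<beta>2 / (lam_min * (1 - \<sigma>)) * \<rho>"
    have "0 < C"
      using assms(2,3) \<open>0 < b\<close> \<open>0 < \<rho>\<close> \<open>0 < lam_min\<close> \<open>\<sigma> < 1\<close> by (simp add: C_def)
    \<comment> \<open>The subgradient at \<open>x k\<close> is \<open>w (k - 1)\<close>, controlled
      by the previous step \<open>d (k - 1)\<close>; \<open>Suc N \<le> k\<close> ensures that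
      \<open>k - 1\<close> is a true predecessor.\<close>
    have rec: "d k \<le> r * d (k - 1) + C * (\<phi> (S k) - \<phi> (S (Suc k)))"
      if k: "Suc N \<le> k" and near: "dist (x k) xt < \<epsilon>" for k
    proof -
      let ?D = "\<phi> (S k) - \<phi> (S (Suc k))" and ?p = "deriv \<phi> (S k)" and ?d = "d (k - 1)"
      let ?a = "lam_min * (1 - \<sigma>)"
      have "0 < ?a" using \<open>0 < lam_min\<close> \<open>\<sigma> < 1\<close> by simp
      have dom_k: "ereal (S k) < \<eta>" using N k by auto
      have "0 < ?p"
        using \<phi> S_pos[of k] dom_k by (auto simp: desingularizing_def)
      have tangent: "?p * (S k - S (Suc k)) \<le> ?D"
        by (rule desingularizing_tangent[OF \<phi> S_pos dom_k less_imp_le[OF S_pos] S_dec])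
      then have "0 \<le> ?D"
        using \<open>0 < ?p\<close> S_dec[of k] by (smt (verit) mult_nonneg_nonneg)
      have "x k \<in> U" using near \<epsilon> by (auto simp: dist_commute)
      moreover have "w (k - 1) \<in> limiting_subdiff f (x k)" using w[of "k - 1"] k by simp
      ultimately have "1 \<le> ?p * norm (w (k - 1))"
        unfolding S_def using KL_inequality_norm[OF KL_xt \<phi> _ _ F f_xt] S_pos[of k] dom_k
        by (auto simp: S_def)
      also have "\<dots> \<le> ?p * (b * \<beta>2 * \<Gamma>' ?d)"
        using \<open>0 < ?p\<close> w_le by (intro mult_left_mono) auto
      \<comment> \<open>Multiplying the KL bound by \<open>?a * \<Gamma> (d k)\<close> makes
        \<open>?p * (?a * \<Gamma> (d k))\<close> appear, which descent and the tangent inequality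
        bound by \<open>?D\<close>.\<close>
      finally have "?a * \<Gamma> (d k) * 1 \<le> ?a * \<Gamma> (d k) * (?p * (b * \<beta>2 * \<Gamma>' ?d))"
        using \<open>0 < ?a\<close> \<Gamma>_nonneg[OF d_nonneg] by (intro mult_left_mono) auto
      also have "\<dots> = (?p * (?a * \<Gamma> (d k))) * (b * \<beta>2 * \<Gamma>' ?d)" by (simp add: mult_ac)
      also have "\<dots> \<le> ?D * (b * \<beta>2 * \<Gamma>' ?d)"
      proof (rule mult_right_mono)
        have "?p * (?a * \<Gamma> (d k)) \<le> ?p * (S k - S (Suc k))"
          using \<open>0 < ?p\<close> descent[of k] by (intro mult_left_mono) (auto simp: S_def)
        with tangent show "?p * (?a * \<Gamma> (d k)) \<le> ?D" by linarith
        show "0 \<le> b * \<beta>2 * \<Gamma>' ?d"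
          using \<open>0 < b\<close> \<open>0 < \<beta>2\<close> \<Gamma>'_nonneg[OF d_nonneg] by simp
      qed
      finally have main: "?a * \<Gamma> (d k) \<le> ?D * (b * \<beta>2) * \<Gamma>' ?d" by (simp add: mult_ac)
      show ?thesis
      \<comment> \<open>The null step joins the easy case, since the growth condition divides by
        \<open>d k\<close>.\<close>
      proof (cases "d k = 0 \<or> d k < r * ?d")
        case True
        moreover have "0 \<le> C * ?D" "0 \<le> r * ?d"
          using \<open>0 < C\<close> \<open>0 \<le> ?D\<close> \<open>0 < r\<close> d_nonneg by auto
        ultimately show ?thesis by linarith
      next
        case False
        then have dk: "0 < d k" "?d \<le> d k / r"
          using d_nonneg[of k] \<open>0 < r\<close> by (auto simp: pos_le_divide_eq mult_ac)
        have "\<Gamma>' ?d \<le> \<Gamma>' (d k / r)"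
          using \<Gamma>'_less[OF d_nonneg, of "k - 1" "d k / r"] dk(2) by (cases "?d = d k / r") auto
        also have "\<dots> \<le> \<rho> * \<Gamma> (d k) / d k"
          using \<Gamma>_growth[OF dk(1)] N(2)[of k] k by simp
        finally have "?D * (b * \<beta>2) * \<Gamma>' ?d \<le> ?D * (b * \<beta>2) * (\<rho> * \<Gamma> (d k) / d k)"
          using \<open>0 \<le> ?D\<close> \<open>0 < b\<close> \<open>0 < \<beta>2\<close> by (intro mult_left_mono) auto
        with main have "?a * \<Gamma> (d k) \<le> ?D * (b * \<beta>2) * \<rho> * \<Gamma> (d k) / d k"
          by (simp add: mult.assoc)
        then have "?a * d k * \<Gamma> (d k) \<le> ?D * (b * \<beta>2) * \<rho> * \<Gamma> (d k)"
          using dk by (simp only: pos_le_divide_eq mult_ac)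
        moreover have "0 < \<Gamma> (d k)"
          using \<Gamma>_less[of 0 "d k"] \<Gamma>_zero dk by simp
        ultimately have "?a * d k \<le> ?D * (b * \<beta>2) * \<rho>"
          by (simp only: mult_le_cancel_right_pos)
        then have "d k \<le> C * ?D"
          using \<open>0 < ?a\<close> by (simp add: C_def pos_le_divide_eq mult_ac)
        moreover have "0 \<le> r * ?d" using \<open>0 < r\<close> d_nonneg by simp
        ultimately show ?thesis by linarith
      qed
    qed
    \<comment> \<open>Subtracting \<open>r * d k\<close> in \<open>rec\<close> leaves
      \<open>(1 - r) * d k\<close> on the left, and the rest is a difference of consecutive
      numerators. The factor \<open>\<beta>1\<close> converts \<open>d k\<close> to the Euclidean
      distance.\<close>
    define P where "P k = (r * d (k - 1) + C * \<phi> (S k)) / ((1 - r) * \<beta>1)" for k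
    have "(\<lambda>k. \<phi> (S k)) \<longlonglongrightarrow> 0"
      using S_pos N(1) by (intro desingularizing_tendsto_zero[OF \<phi> \<open>0 < \<eta>\<close> S_lim]
          eventually_sequentiallyI[of N]) (auto intro: less_imp_le)
    moreover have "(\<lambda>k. d (k - 1)) \<longlonglongrightarrow> 0"
      using d_lim by (subst filterlim_sequentially_Suc[symmetric]) simp
    ultimately have "P \<longlonglongrightarrow> 0"
      unfolding P_def using \<open>r < 1\<close> \<open>0 < \<beta>1\<close> by (auto intro!: tendsto_eq_intros)
    moreover have "0 \<le> P k" if "Suc N \<le> k" for k
    proof -
      have "0 \<le> \<phi> (S k)"
        using \<phi> S_pos[of k] N(1)[of k] that by (auto simp: desingularizing_def)
      then show ?thesis
        using \<open>0 < C\<close> \<open>0 < r\<close> \<open>r < 1\<close> \<open>0 < \<beta>1\<close> d_nonneg by (simp add: P_def)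
    qed
    moreover have "dist (x k) (x (Suc k)) \<le> P k - P (Suc k)"
      if "Suc N \<le> k" "dist (x k) xt < \<epsilon>" for k
    proof -
      have "d k * (1 - r) \<le> r * d (k - 1) + C * \<phi> (S k) - (r * d k + C * \<phi> (S (Suc k)))"
        using rec[OF that] by (simp add: algebra_simps)
      then have "d k * (1 - r) / ((1 - r) * \<beta>1) \<le>
          (r * d (k - 1) + C * \<phi> (S k) - (r * d k + C * \<phi> (S (Suc k)))) / ((1 - r) * \<beta>1)"
        using \<open>r < 1\<close> \<open>0 < \<beta>1\<close> by (intro divide_right_mono) auto
      also have "\<dots> = P k - P (Suc k)"
        by (simp add: P_def diff_divide_distrib)
      finally have "d k * (1 - r) / ((1 - r) * \<beta>1) \<le> P k - P (Suc k)" .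
      moreover have "dist (x k) (x (Suc k)) \<le> d k / \<beta>1"
        using q_norm[of "x k" "x (Suc k)"] \<open>0 < \<beta>1\<close>
        by (simp add: d_def dist_norm pos_le_divide_eq mult_ac)
      ultimately show ?thesis using \<open>r < 1\<close> by simp
    qed
    ultimately show ?thesis
      using tendsto_of_local_potential_descent[OF \<tau> _ _ \<epsilon>(1)] by blast
  qed

  \<comment> \<open>Criticality of the limit\<close>
  have "critical_point f xt"
    unfolding critical_point_def
    using limiting_subdiff_closed[OF xt_dom LIMSEQ_Suc[OF conv] _ w w_lim]
      LIMSEQ_Suc[OF f_lim] by (simp add: f_xt)

  \<comment> \<open>The strong global trap property\<close>
  have trap: "f xt - f y < ereal (l * \<Gamma> (q xt y))" if l: "lam_inf < l" and "y \<noteq> xt" for l y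
  proof (cases "f y")
    case (real a)
    have q_xt: "(\<lambda>k. q (x k) y) \<longlonglongrightarrow> q xt y"
    proof (rule LIM_zero_cancel, rule Lim_null_comparison)
      have "\<bar>q (x k) y - q xt y\<bar> \<le> \<beta>2 * dist (x k) xt" for k
        using q_tri[of "x k" y xt] q_tri[of xt y "x k"] q_norm[of "x k" xt] q_norm[of xt "x k"]
        by (simp add: dist_norm norm_minus_commute abs_le_iff)
      then show "\<forall>\<^sub>F k in sequentially. norm (q (x k) y - q xt y) \<le> \<beta>2 * dist (x k) xt"
        by simp
      show "(\<lambda>k. \<beta>2 * dist (x k) xt) \<longlonglongrightarrow> 0"
        using conv by (intro tendsto_mult_right_zero) (simp add: tendsto_dist_iff[symmetric])
    qed
    have \<Gamma>_lim: "(\<lambda>k. \<Gamma> (q (x k) y)) \<longlonglongrightarrow> \<Gamma> (q xt y)"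
      by (rule continuous_on_tendsto_compose[OF \<Gamma>_cont q_xt]) (auto simp: q_nonneg)
    \<comment> \<open>The nonnegative term with \<open>1 - \<sigma>\<close> is dropped from the
      proximal inequality.\<close>
    have "F (Suc k) - a \<le> lam k * \<Gamma> (q (x k) y)" for k
    proof -
      have "0 \<le> lam k * ((1 - \<sigma>) * \<Gamma> (d k))"
        using lam(1)[of k] \<open>0 < lam_min\<close> \<open>\<sigma> < 1\<close> \<Gamma>_nonneg[OF d_nonneg] by simp
      then show ?thesis
        using prox[where y = y and k = k] real by (simp add: F algebra_simps)
    qed
    \<comment> \<open>The limit is taken along \<open>\<kappa>\<close>, where the parameters
      \<open>lam\<close> converge.\<close>
    moreover have "(\<lambda>k. F (Suc (\<kappa> k)) - a) \<longlonglongrightarrow> Finf - a"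
      using LIMSEQ_subseq_LIMSEQ[OF LIMSEQ_Suc[OF Finf(1)] lam_inf(1)]
      by (intro tendsto_diff) (auto simp: o_def)
    moreover have "(\<lambda>k. lam (\<kappa> k) * \<Gamma> (q (x (\<kappa> k)) y)) \<longlonglongrightarrow> lam_inf * \<Gamma> (q xt y)"
      using lam_inf(2) LIMSEQ_subseq_LIMSEQ[OF \<Gamma>_lim lam_inf(1)]
      by (intro tendsto_mult) (auto simp: o_def)
    ultimately have "Finf - a \<le> lam_inf * \<Gamma> (q xt y)"
      by (auto intro: LIMSEQ_le)
    moreover have "0 < q xt y"
      using q_nonneg[of xt y] q_eq[of xt y] \<open>y \<noteq> xt\<close> by simp
    \<comment> \<open>Passing to the limit loses strictness; \<open>lam_inf < l\<close> and
      \<open>0 < \<Gamma> (q xt y)\<close> restore it.\<close>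
    then have "lam_inf * \<Gamma> (q xt y) < l * \<Gamma> (q xt y)"
      using \<Gamma>_less[of 0 "q xt y"] \<Gamma>_zero l by simp
    ultimately show ?thesis
      using real by (simp add: f_xt)
  \<comment> \<open>For \<open>f y = \<infinity>\<close> the left side is
    \<open>-\<infinity>\<close>; the lower bound \<open>m\<close> excludes
    \<open>f y = -\<infinity>\<close>.\<close>
  qed (use m[of y] f_xt in auto)
  have "strong_global_trap f q \<Gamma> l xt" if "lam_inf < l" for l
  proof -
    have "xt \<in> worthwhile_set f q \<Gamma> l xt"
      by (simp add: worthwhile_set_def f_xt q_refl \<Gamma>_zero)
    then show ?thesis
      using trap[OF that] by (auto simp: strong_global_trap_def worthwhile_set_def not_le[symmetric])
  qed
  with conv \<open>critical_point f xt\<close> trap show ?thesis by blast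
qed

end
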